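(* Let $K(n,d)$ be the supremum, over all initial conditions (positions and velocities), of the number of elastic collisions of $n$ balls of equal radii and equal masses in $\mathbb{R}^d$. For all integers $4\le n\le 6$ and $d\ge 2$, $$K(n,d)\ge K(n,2)\ge 1+\frac{n(n-1)}{2}.$$
   Context: Dynamics. Consider $n$ balls in $\mathbb{R}^d$, all of radius 1 and identical masses, with pairwise disjoint interiors at all times, evolving over all times $t\in(-\infty,\infty)$. Each ball moves with constant velocity between collisions. If two balls with centers $x(t),y(t)$ touch at time $t$ (i.e. $|x(t)-y(t)|=2$), no other ball touches either of them at time $t$, and the velocities just before satisfy $(Dx(t-)-Dy(t-))\cdot(x(t)-y(t))<0$, then with $\mathbf{x}=x(t)-y(t)$ and $P_w z=(z\cdot w)w/|w|^2$ the velocities just after are $$Dx(t)=Dx(t-)-P_{\mathbf{x}}(D(x-y)(t-)),\qquad Dy(t)=Dy(t-)-P_{\mathbf{x}}(D(y-x)(t-)).$$ Here $D$ denotes the right derivative in time and $t-$ a left limit. A simultaneous collision at time $t$ means that some collection of at least 3 balls is connected via contacts (tangencies) at time $t$. Only evolutions without simultaneous collisions are considered (contacts of disjoint pairs of balls at the same time are allowed). Collisions. A collision of two balls at a space-time point $(y,t)$ is counted if and only if: (i) the two balls are tangent at $y$ at time $t$; (ii) for some $\varepsilon>0$ the two balls do not touch during $(t-\varepsilon,t)$ and $(t,t+\varepsilon)$; (iii) both balls change velocity at time $t$. (In particular grazing contacts are not counted.) $K(n,d)$ is the supremum of the total number of collisions during $(-\infty,\infty)$ over all such evolutions. *)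

theory Defs
  imports "HOL-Analysis.Analysis" "HOL-Library.Extended_Nat"
begin

text \<open>
  An evolution of \<open>n\<close> unit balls is a family \<open>x\<close> of trajectories of centers: \<open>x i t\<close> is the
  center of ball \<open>i\<close> at time \<open>t\<close>. Only the indices \<open>i < n\<close> matter.
\<close>

definition rderiv :: "(real \<Rightarrow> 'a::euclidean_space) \<Rightarrow> real \<Rightarrow> 'a" where
  "rderiv f t = vector_derivative f (at_right t)"

definition rderiv_before :: "(real \<Rightarrow> 'a::euclidean_space) \<Rightarrow> real \<Rightarrow> 'a" where
  "rderiv_before f t = Lim (at_left t) (rderiv f)"

definition proj_along :: "'a::euclidean_space \<Rightarrow> 'a \<Rightarrow> 'a" where
  "proj_along w z = ((z \<bullet> w) / (norm w)\<^sup>2) *\<^sub>R w"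

definition touching :: "(nat \<Rightarrow> real \<Rightarrow> 'a::euclidean_space) \<Rightarrow> nat \<Rightarrow> nat \<Rightarrow> real \<Rightarrow> bool" where
  "touching x i j t \<longleftrightarrow> i \<noteq> j \<and> dist (x i t) (x j t) = 2"

definition simultaneous_collision ::
    "nat \<Rightarrow> (nat \<Rightarrow> real \<Rightarrow> 'a::euclidean_space) \<Rightarrow> real \<Rightarrow> bool" where
  "simultaneous_collision n x t \<longleftrightarrow>
     (\<exists>S \<subseteq> {..<n}. card S \<ge> 3 \<and>
        (\<forall>i\<in>S. \<forall>j\<in>S. (i, j) \<in> {(k, l). k \<in> S \<and> l \<in> S \<and> touching x k l t}\<^sup>*))"

text \<open>
  The situation in which the reflection law applies to balls \<open>i\<close> and \<open>j\<close>. Contacts that are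
  not approaching (grazing, or balls resting against each other) are not impacts and leave the
  velocities unchanged.
\<close>

definition impact ::
    "nat \<Rightarrow> (nat \<Rightarrow> real \<Rightarrow> 'a::euclidean_space) \<Rightarrow> nat \<Rightarrow> nat \<Rightarrow> real \<Rightarrow> bool" where
  "impact n x i j t \<longleftrightarrow>
     touching x i j t \<and>
     (\<forall>k<n. k \<noteq> i \<and> k \<noteq> j \<longrightarrow> \<not> touching x k i t \<and> \<not> touching x k j t) \<and>
     (rderiv_before (x i) t - rderiv_before (x j) t) \<bullet> (x i t - x j t) < 0"

text \<open>
  The reflection law is stated for every ordered pair \<open>(i, j)\<close>, so it also covers ball \<open>j\<close>.
\<close>

definition evolution :: "nat \<Rightarrow> (nat \<Rightarrow> real \<Rightarrow> 'a::euclidean_space) \<Rightarrow> bool" where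
  "evolution n x \<longleftrightarrow>
     (\<forall>i<n. continuous_on UNIV (x i) \<and>
        (\<forall>t. x i differentiable (at_right t)) \<and>
        (\<forall>t. \<exists>l. (rderiv (x i) \<longlongrightarrow> l) (at_left t))) \<and>
     (\<forall>i<n. \<forall>j<n. \<forall>t. i \<noteq> j \<longrightarrow> ball (x i t) 1 \<inter> ball (x j t) 1 = {}) \<and>
     (\<forall>i<n. \<forall>a b. a < b \<and> (\<forall>t\<in>{a<..<b}. \<forall>j<n. \<not> impact n x i j t) \<longrightarrow>
        rderiv (x i) constant_on {a<..<b}) \<and>
     (\<forall>i<n. \<forall>j<n. \<forall>t. impact n x i j t \<longrightarrow>
        rderiv (x i) t = rderiv_before (x i) t -
          proj_along (x i t - x j t) (rderiv_before (x i) t - rderiv_before (x j) t)) \<and>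
     (\<forall>t. \<not> simultaneous_collision n x t)"

text \<open>
  A collision is recorded as \<open>(i, j, y, t)\<close> with \<open>i < j\<close>, so that each unordered pair of balls
  occurs once; \<open>y\<close> is the point of tangency.
\<close>

definition collisions ::
    "nat \<Rightarrow> (nat \<Rightarrow> real \<Rightarrow> 'a::euclidean_space) \<Rightarrow> (nat \<times> nat \<times> 'a \<times> real) set" where
  "collisions n x = {(i, j, y, t). i < j \<and> j < n \<and>
     touching x i j t \<and> y \<in> cball (x i t) 1 \<inter> cball (x j t) 1 \<and>
     (\<exists>\<epsilon>>0. \<forall>s\<in>{t - \<epsilon><..<t} \<union> {t<..<t + \<epsilon>}. \<not> touching x i j s) \<and>
     rderiv (x i) t \<noteq> rderiv_before (x i) t \<and>
     rderiv (x j) t \<noteq> rderiv_before (x j) t}"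

definition num_collisions :: "nat \<Rightarrow> (nat \<Rightarrow> real \<Rightarrow> 'a::euclidean_space) \<Rightarrow> enat" where
  "num_collisions n x =
     (if finite (collisions n x) then enat (card (collisions n x)) else \<infinity>)"

text \<open>
  \<open>K n TYPE('d)\<close> is \<open>K(n, d)\<close> with \<open>d = CARD('d)\<close>; the type serves only to carry the dimension.
\<close>

definition K :: "nat \<Rightarrow> 'd::finite itself \<Rightarrow> enat" where
  "K n d = (SUP x \<in> {x :: nat \<Rightarrow> real \<Rightarrow> real ^ 'd. evolution n x}. num_collisions n x)"

end

theory Submission
  imports Defs
begin

text \<open>
  Let the balls \<open>B, C, D, \<dots>\<close> move along a line with decreasing velocities. Each collision swaps
  two velocities, and each pair of velocities is swapped once before the balls drift apart: these
  are \<open>(n - 1) (n - 2) / 2\<close> collisions. Afterwards a ball \<open>A\<close> comes from outside the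
  line and strikes \<open>B\<close> obliquely, \<open>B\<close> strikes \<open>C\<close> slightly off-center, \<open>C\<close> strikes \<open>D\<close>, and so on down the chain: these are \<open>n - 1\<close> further collisions. As \<open>C\<close> is
  deflected towards the slowly passing ball \<open>A\<close>, these two collide as well, which is one collision
  more than in dimension one. If the collision normals are prescribed as rational unit vectors,
  the unknown times and positions solve linear equations, so the evolution can be given by rational
  data and verified in integer arithmetic. An isometric embedding of the plane preserves evolutions
  and their collisions.
\<close>

section \<open>Piecewise linear evolutions\<close>

text \<open>The line \<open>d + s *\<^sub>R w\<close> has squared distance
  \<open>d \<bullet> d - (d \<bullet> w)\<^sup>2 / (w \<bullet> w)\<close> from the origin. The
  condition says that this exceeds 4, cleared of the denominator; strictness forces \<open>w\<close>
  to be nonzero.\<close>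

definition misses :: "'a::real_inner \<Rightarrow> 'a \<Rightarrow> bool" where
  "misses d w \<longleftrightarrow> (d \<bullet> w)\<^sup>2 + 4 * (w \<bullet> w) < (d \<bullet> d) * (w \<bullet> w)"

lemma norm_gt_2_iff: "2 < norm d \<longleftrightarrow> 4 < d \<bullet> d" for d :: "'a::real_inner"
  by (simp add: norm_gt_square)

lemma misses_imp_norm_gt_2:
  assumes "misses d w"
  shows "2 < norm (d + s *\<^sub>R w)"
proof -
  have w: "0 < w \<bullet> w"
    using assms by (auto simp: misses_def)
  have "4 * (w \<bullet> w) < (d \<bullet> d) * (w \<bullet> w) - (d \<bullet> w)\<^sup>2"
    using assms by (simp add: misses_def)
  \<comment> \<open>Completing the square in \<open>s\<close>: the added term vanishes at the point
    of closest approach.\<close>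
  also have "\<dots> \<le> (d \<bullet> d) * (w \<bullet> w) - (d \<bullet> w)\<^sup>2 + (d \<bullet> w + s * (w \<bullet> w))\<^sup>2"
    by simp
  also have "\<dots> = ((d + s *\<^sub>R w) \<bullet> (d + s *\<^sub>R w)) * (w \<bullet> w)"
    by (simp add: inner_add_left inner_add_right inner_commute power2_eq_square algebra_simps)
  finally show ?thesis
    using w by (simp add: norm_gt_2_iff)
qed

text \<open>In the expansion of the squared norm the linear term in \<open>s\<close> is positive and
  the quadratic one nonnegative. Applied to \<open>- w\<close>, this handles motion backwards in
  time.\<close>

lemma receding_imp_norm_gt_2:
  assumes "2 \<le> norm d" and "0 < d \<bullet> w" and "0 < s"
  shows "2 < norm (d + s *\<^sub>R w)"
proof -
  have "2\<^sup>2 \<le> (norm d)\<^sup>2"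
    using assms(1) by (intro power_mono) auto
  then have "4 \<le> d \<bullet> d"
    by (simp add: power2_norm_eq_inner)
  moreover have "0 < s * (d \<bullet> w)" "0 \<le> s * s * (w \<bullet> w)"
    using assms by auto
  ultimately have "4 < d \<bullet> d + 2 * (s * (d \<bullet> w)) + s * s * (w \<bullet> w)"
    by linarith
  also have "\<dots> = (d + s *\<^sub>R w) \<bullet> (d + s *\<^sub>R w)"
    by (simp add: inner_add_left inner_add_right inner_commute)
  finally show ?thesis
    by (simp add: norm_gt_2_iff)
qed

text \<open>
  Row \<open>k \<le> m\<close> of the table holds the centers \<open>X k\<close> at time \<open>c k\<close> and the velocities \<open>V k\<close> right after
  it. Every row but the first begins with the collision of the balls \<open>I (k - 1)\<close> and \<open>J (k - 1)\<close>;
  at time \<open>c 0\<close> nothing happens. The squared distance of two balls in free flight is convex in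
  time, so it suffices that they separate at the beginning of the flight, approach each other at
  its end, or move along lines that stay more than \<open>2\<close> apart.
\<close>

locale flight_table =
  fixes n m :: nat
    and c :: "nat \<Rightarrow> real"
    and X V :: "nat \<Rightarrow> nat \<Rightarrow> 'a::euclidean_space"
    and I J :: "nat \<Rightarrow> nat"
  assumes c_less_Suc: "k < m \<Longrightarrow> c k < c (Suc k)"
    and X_Suc: "k < m \<Longrightarrow> i < n \<Longrightarrow> X (Suc k) i = X k i + (c (Suc k) - c k) *\<^sub>R V k i"
    and pair: "k < m \<Longrightarrow> I k < J k \<and> J k < n"
    and contact: "k < m \<Longrightarrow> norm (X (Suc k) (I k) - X (Suc k) (J k)) = 2"
    and approach: "k < m \<Longrightarrow>
      (V k (I k) - V k (J k)) \<bullet> (X (Suc k) (I k) - X (Suc k) (J k)) < 0"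
    and V_Suc_I: "k < m \<Longrightarrow> V (Suc k) (I k) = V k (I k) -
      proj_along (X (Suc k) (I k) - X (Suc k) (J k)) (V k (I k) - V k (J k))"
    and V_Suc_J: "k < m \<Longrightarrow> V (Suc k) (J k) = V k (J k) -
      proj_along (X (Suc k) (J k) - X (Suc k) (I k)) (V k (J k) - V k (I k))"
    and V_Suc_other: "k < m \<Longrightarrow> i < n \<Longrightarrow> i \<noteq> I k \<Longrightarrow> i \<noteq> J k \<Longrightarrow> V (Suc k) i = V k i"
    and apart_0: "i < j \<Longrightarrow> j < n \<Longrightarrow> 2 < norm (X 0 i - X 0 j)"
    and apart_Suc: "k < m \<Longrightarrow> i < j \<Longrightarrow> j < n \<Longrightarrow> (i, j) \<noteq> (I k, J k) \<Longrightarrow>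
      2 < norm (X (Suc k) i - X (Suc k) j)"
    and past: "i < j \<Longrightarrow> j < n \<Longrightarrow> misses (X 0 i - X 0 j) (V 0 i - V 0 j) \<or>
      (X 0 i - X 0 j) \<bullet> (V 0 i - V 0 j) < 0"
    and between: "k < m \<Longrightarrow> i < j \<Longrightarrow> j < n \<Longrightarrow> misses (X k i - X k j) (V k i - V k j) \<or>
      0 < (X k i - X k j) \<bullet> (V k i - V k j) \<or>
      (X (Suc k) i - X (Suc k) j) \<bullet> (V k i - V k j) < 0"
    and future: "i < j \<Longrightarrow> j < n \<Longrightarrow> misses (X m i - X m j) (V m i - V m j) \<or>
      0 < (X m i - X m j) \<bullet> (V m i - V m j)"
begin

text \<open>Row \<open>0\<close> extended to all times plus one ramp per collision, zero before the
  collision and adding the jump of velocity after it. A single formula makes continuity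
  immediate.\<close>

definition traj :: "nat \<Rightarrow> real \<Rightarrow> 'a" where
  "traj i t = X 0 i + (t - c 0) *\<^sub>R V 0 i +
     (\<Sum>k<m. max 0 (t - c (Suc k)) *\<^sub>R (V (Suc k) i - V k i))"

text \<open>\<open>phase k t\<close>: row \<open>k\<close> describes the motion around time \<open>t\<close>; the first and the last row
  extend to infinite time.\<close>

definition phase :: "nat \<Rightarrow> real \<Rightarrow> bool" where
  "phase k t \<longleftrightarrow> k \<le> m \<and> (k = 0 \<or> c k \<le> t) \<and> (k = m \<or> t \<le> c (Suc k))"

lemma c_mono: "k \<le> l \<Longrightarrow> l \<le> m \<Longrightarrow> c k \<le> c l"
proof (induction l rule: dec_induct)
  case (step l)
  then show ?case using c_less_Suc[of l] by simp
qed simp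

lemma c_strict_mono: "k < l \<Longrightarrow> l \<le> m \<Longrightarrow> c k < c l"
  using c_less_Suc[of k] c_mono[of "Suc k" l] by force

lemma c_inj: "k \<le> m \<Longrightarrow> l \<le> m \<Longrightarrow> c k = c l \<Longrightarrow> k = l"
  using c_strict_mono by (metis less_irrefl linorder_neqE_nat)

text \<open>Adding the jump at \<open>c (Suc l)\<close> turns the line of row \<open>l\<close> into
  that of row \<open>l + 1\<close>, since the two lines meet at that time.\<close>

lemma prefix_sum:
  assumes "k \<le> m" and "i < n"
  shows "X 0 i + (t - c 0) *\<^sub>R V 0 i +
     (\<Sum>l<k. (t - c (Suc l)) *\<^sub>R (V (Suc l) i - V l i)) = X k i + (t - c k) *\<^sub>R V k i"
  using assms(1)
proof (induction k)
  case (Suc k)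
  have "X k i + (t - c k) *\<^sub>R V k i + (t - c (Suc k)) *\<^sub>R (V (Suc k) i - V k i) =
      X (Suc k) i + (t - c (Suc k)) *\<^sub>R V (Suc k) i"
    using X_Suc[of k i] Suc.prems assms(2) by (simp add: algebra_simps)
  then show ?case
    using Suc by (simp add: add.assoc[symmetric])
qed simp

lemma traj_eq:
  assumes "phase k t" and "i < n"
  shows "traj i t = X k i + (t - c k) *\<^sub>R V k i"
proof -
  have km: "k \<le> m" using assms by (simp add: phase_def)
  have "(\<Sum>l<m. max 0 (t - c (Suc l)) *\<^sub>R (V (Suc l) i - V l i)) =
      (\<Sum>l<k. (t - c (Suc l)) *\<^sub>R (V (Suc l) i - V l i))"
  proof (rule sum.mono_neutral_cong_right)
    show "\<forall>l\<in>{..<m} - {..<k}. max 0 (t - c (Suc l)) *\<^sub>R (V (Suc l) i - V l i) = 0"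
    proof
      fix l assume "l \<in> {..<m} - {..<k}"
      then have "c (Suc k) \<le> c (Suc l)" "k \<noteq> m"
        by (auto intro!: c_mono)
      then show "max 0 (t - c (Suc l)) *\<^sub>R (V (Suc l) i - V l i) = 0"
        using assms by (auto simp: phase_def max_def)
    qed
    show "max 0 (t - c (Suc l)) *\<^sub>R (V (Suc l) i - V l i) =
        (t - c (Suc l)) *\<^sub>R (V (Suc l) i - V l i)" if "l \<in> {..<k}" for l
      using that km assms c_mono[of "Suc l" k] by (auto simp: phase_def max_def)
  qed (use km in auto)
  then show ?thesis
    using prefix_sum[OF km assms(2)] by (simp add: traj_def)
qed

text \<open>The row sought is the last one begun by time \<open>t\<close>. A collision time belongs
  to the new row here and to the old one in \<open>phase_left\<close>, in accordance with right
  derivatives and left limits.\<close>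

lemma phase_right:
  obtains k \<delta> where "k \<le> m" "\<delta> > 0" "k = 0 \<or> c k \<le> t" "k = m \<or> t < c (Suc k)"
    "\<And>s. t \<le> s \<Longrightarrow> s < t + \<delta> \<Longrightarrow> phase k s"
proof -
  define A where "A = {k. k \<le> m \<and> (k = 0 \<or> c k \<le> t)}"
  have fin: "finite A" and ne: "A \<noteq> {}"
    by (auto simp: A_def)
  define k where "k = Max A"
  have kA: "k \<in> A"
    using fin ne by (simp add: k_def)
  have "Suc k \<notin> A"
    using Max_ge[OF fin, of "Suc k"] by (auto simp: k_def)
  then have k: "k \<le> m" "k = 0 \<or> c k \<le> t" "k = m \<or> t < c (Suc k)"
    using kA by (auto simp: A_def)
  define \<delta> where "\<delta> = (if k = m then 1 else c (Suc k) - t)"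
  show thesis
    by (rule that[of k \<delta>]) (use k in \<open>auto simp: \<delta>_def phase_def split: if_splits\<close>)
qed

lemma phase_left:
  obtains k \<delta> where "k \<le> m" "\<delta> > 0" "k = 0 \<or> c k < t" "k = m \<or> t \<le> c (Suc k)"
    "\<And>s. t - \<delta> < s \<Longrightarrow> s \<le> t \<Longrightarrow> phase k s"
proof -
  define A where "A = {k. k \<le> m \<and> (k = 0 \<or> c k < t)}"
  have fin: "finite A" and ne: "A \<noteq> {}"
    by (auto simp: A_def)
  define k where "k = Max A"
  have kA: "k \<in> A"
    using fin ne by (simp add: k_def)
  have "Suc k \<notin> A"
    using Max_ge[OF fin, of "Suc k"] by (auto simp: k_def)
  then have k: "k \<le> m" "k = 0 \<or> c k < t" "k = m \<or> t \<le> c (Suc k)"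
    using kA by (auto simp: A_def not_less)
  define \<delta> where "\<delta> = (if k = 0 then 1 else t - c k)"
  show thesis
    by (rule that[of k \<delta>]) (use k in \<open>auto simp: \<delta>_def phase_def split: if_splits\<close>)
qed

section \<open>One-sided velocities of the trajectories\<close>

lemma rderiv_traj:
  assumes "k \<le> m" "k = 0 \<or> c k \<le> t" "k = m \<or> t < c (Suc k)" "i < n"
  shows "(traj i has_vector_derivative V k i) (at_right t)" and "rderiv (traj i) t = V k i"
proof -
  define \<delta> where "\<delta> = (if k = m then 1 else c (Suc k) - t)"
  have \<delta>: "\<delta> > 0"
    using assms by (auto simp: \<delta>_def)
  have eq: "X k i + (s - c k) *\<^sub>R V k i = traj i s" if "s \<in> {t..}" "dist s t < \<delta>" for s
    using that assms
    by (intro traj_eq[symmetric]) (auto simp: \<delta>_def phase_def dist_real_def split: if_splits)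
  have "((\<lambda>s. X k i + (s - c k) *\<^sub>R V k i) has_vector_derivative V k i) (at t within {t..})"
    by (auto intro!: derivative_eq_intros)
  then have "(traj i has_vector_derivative V k i) (at t within {t..})"
    by (rule has_vector_derivative_transform_within[OF _ \<delta> _ eq]) auto
  then show *: "(traj i has_vector_derivative V k i) (at_right t)"
    by (rule has_vector_derivative_within_subset) auto
  show "rderiv (traj i) t = V k i"
    unfolding rderiv_def by (rule vector_derivative_within[OF _ *]) simp
qed

lemma rderiv_before_traj:
  assumes "k \<le> m" "k = 0 \<or> c k < t" "k = m \<or> t \<le> c (Suc k)" "i < n"
  shows "(rderiv (traj i) \<longlongrightarrow> V k i) (at_left t)" and "rderiv_before (traj i) t = V k i"
proof -
  define b where "b = (if k = 0 then t - 1 else c k)"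
  have "eventually (\<lambda>s. s \<in> {b<..<t}) (at_left t)"
    using assms by (intro eventually_at_left_real) (auto simp: b_def)
  then have "eventually (\<lambda>s. rderiv (traj i) s = V k i) (at_left t)"
    by eventually_elim (rule rderiv_traj(2); use assms in \<open>auto simp: b_def split: if_splits\<close>)
  then show *: "(rderiv (traj i) \<longlongrightarrow> V k i) (at_left t)"
    by (rule tendsto_eventually)
  show "rderiv_before (traj i) t = V k i"
    unfolding rderiv_before_def by (rule tendsto_Lim[OF _ *]) simp
qed

lemma traj_at_collision: "k < m \<Longrightarrow> i < n \<Longrightarrow> traj i (c (Suc k)) = X (Suc k) i"
  using traj_eq[of "Suc k" "c (Suc k)" i] c_less_Suc[of "Suc k"] by (force simp: phase_def)

lemma velocities_at_collision:
  assumes "k < m" "i < n"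
  shows "rderiv_before (traj i) (c (Suc k)) = V k i" and "rderiv (traj i) (c (Suc k)) = V (Suc k) i"
  using assms c_less_Suc[of k] c_less_Suc[of "Suc k"]
  by (force intro!: rderiv_traj rderiv_before_traj)+

lemma I_J_less: "k < m \<Longrightarrow> I k < n" "k < m \<Longrightarrow> J k < n" "k < m \<Longrightarrow> I k < J k"
  using pair[of k] by auto

section \<open>Contacts happen only at the listed collisions\<close>

lemma norm_X_ge_2:
  assumes "k \<le> m" "i < j" "j < n"
  shows "2 \<le> norm (X k i - X k j)"
proof (cases k)
  case 0
  then show ?thesis using apart_0 assms by force
next
  case (Suc l)
  then show ?thesis
    using apart_Suc[of l i j] contact[of l] assms by (cases "(i, j) = (I l, J l)") force+
qed

lemma norm_traj_cases:
  assumes ij: "i < j" "j < n"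
  shows "2 < norm (traj i t - traj j t) \<or>
    (\<exists>k<m. t = c (Suc k) \<and> i = I k \<and> j = J k)"
proof (cases "\<exists>k<m. t = c (Suc k)")
  case True
  then obtain k where k: "k < m" "t = c (Suc k)" by blast
  then show ?thesis
    using ij apart_Suc[of k i j] by (cases "(i, j) = (I k, J k)") (auto simp: traj_at_collision)
next
  case False
  obtain k \<delta> where k: "k \<le> m" "k = 0 \<or> c k \<le> t" "k = m \<or> t < c (Suc k)" and "phase k t"
    using phase_right[of t] by (metis add.commute less_add_same_cancel2 order_refl)
  have pos: "k \<noteq> 0 \<Longrightarrow> c k < t"
    using False k by (cases k) (auto simp: less_le Suc_le_eq)
  define d w where "d = X k i - X k j" and "w = V k i - V k j"
  have traj: "traj i t - traj j t = d + (t - c k) *\<^sub>R w"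
    using \<open>phase k t\<close> ij by (simp add: traj_eq d_def w_def algebra_simps)
  have d2: "2 \<le> norm d"
    using norm_X_ge_2 k ij by (simp add: d_def)
  have recede: ?thesis if "0 < d \<bullet> w" "c k < t"
    using receding_imp_norm_gt_2[OF d2, of w "t - c k"] that traj by simp
  show ?thesis
  proof (cases "misses d w")
    case True
    then show ?thesis using misses_imp_norm_gt_2 traj by metis
  next
    case nm: False
    \<comment> \<open>Row \<open>0\<close> covers both sides of \<open>c 0\<close>, where nothing
      happens. Every other row begins at a collision time, which is excluded here.\<close>
    consider "k = 0" "t < c 0" | "k = 0" "t = c 0" | "c k < t" "k = m" | "c k < t" "k < m"
      using pos k by force
    then show ?thesis
    proof cases
      case 1
      then have "d \<bullet> w < 0"
        using past[OF ij] nm by (auto simp: d_def w_def)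
      moreover have "traj i t - traj j t = d + (c 0 - t) *\<^sub>R (- w)"
        by (simp add: traj 1 algebra_simps)
      ultimately show ?thesis
        using receding_imp_norm_gt_2[OF d2, of "- w" "c 0 - t"] 1 by simp
    next
      case 2
      then show ?thesis using apart_0[OF ij] traj by (simp add: d_def)
    next
      case 3
      then show ?thesis
        using future[OF ij] nm recede by (simp add: d_def w_def)
    next
      case 4
      define d' where "d' = X (Suc k) i - X (Suc k) j"
      have d': "d' = d + (c (Suc k) - c k) *\<^sub>R w"
        using X_Suc[of k i] X_Suc[of k j] 4 ij
        unfolding d_def d'_def w_def by (simp add: scaleR_diff_right)
      have "0 < d \<bullet> w \<or> d' \<bullet> w < 0"
        using between[OF \<open>k < m\<close> ij] nm by (auto simp: d_def d'_def w_def)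
      moreover have ?thesis if "d' \<bullet> w < 0"
      proof -
        have "2 \<le> norm d'"
          using norm_X_ge_2[of "Suc k"] 4 ij by (simp add: d'_def)
        \<comment> \<open>The flight is traced backwards from its end, hence the velocity
          \<open>- w\<close>.\<close>
        moreover have "traj i t - traj j t = d' + (c (Suc k) - t) *\<^sub>R (- w)"
          by (simp add: traj d' algebra_simps)
        ultimately show ?thesis
          using receding_imp_norm_gt_2[of d' "- w" "c (Suc k) - t"] that k 4 by simp
      qed
      ultimately show ?thesis
        using recede 4 by blast
    qed
  qed
qed

lemma touching_traj_iff:
  assumes "i < n" "j < n"
  shows "touching traj i j t \<longleftrightarrow>
    (\<exists>k<m. t = c (Suc k) \<and> (i = I k \<and> j = J k \<or> i = J k \<and> j = I k))" (is "_ \<longleftrightarrow> ?R i j")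
proof -
  have *: "touching traj i j t \<longleftrightarrow> ?R i j" if ij: "i < j" "j < n" for i j
  proof
    assume "touching traj i j t"
    then show "?R i j"
      using norm_traj_cases[OF ij, of t] by (auto simp: touching_def dist_norm)
  next
    assume "?R i j"
    then obtain k where k: "k < m" "t = c (Suc k)" "i = I k \<and> j = J k \<or> i = J k \<and> j = I k"
      by blast
    moreover from this have "i = I k" "j = J k"
      using ij I_J_less(3)[OF k(1)] by linarith+
    ultimately show "touching traj i j t"
      using contact[of k] ij by (auto simp: touching_def dist_norm traj_at_collision)
  qed
  consider "i < j" | "i = j" | "j < i" by linarith
  then show ?thesis
  proof cases
    case 1
    then show ?thesis using * assms by blast
  next
    case 2
    have "\<not> ?R i j"
    proof
      assume "?R i j"
      then obtain k where "k < m" "i = I k \<and> j = J k \<or> i = J k \<and> j = I k"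
        by blast
      with 2 I_J_less(3)[of k] show False
        by linarith
    qed
    moreover have "\<not> touching traj i j t"
      using 2 by (simp add: touching_def)
    ultimately show ?thesis
      by (simp only: simp_thms)
  next
    case 3
    have "touching traj i j t \<longleftrightarrow> touching traj j i t"
      by (auto simp: touching_def dist_commute)
    also have "\<dots> \<longleftrightarrow> ?R j i"
      using 3 assms by (intro *)
    also have "\<dots> \<longleftrightarrow> ?R i j"
      by blast
    finally show ?thesis .
  qed
qed

lemma dist_traj_ge_2: "i < n \<Longrightarrow> j < n \<Longrightarrow> i \<noteq> j \<Longrightarrow> 2 \<le> dist (traj i t) (traj j t)"
proof (induction i j rule: linorder_wlog)
  case (le i j)
  then show ?case
    using norm_traj_cases[of i j t] contact by (auto simp: dist_norm traj_at_collision I_J_less)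
next
  case (sym i j)
  then show ?case by (simp add: dist_commute)
qed

section \<open>Impacts, absence of simultaneous collisions, and the count\<close>

lemma collision_unique:
  assumes "k < m" "l < m" "c (Suc k) = c (Suc l)"
  shows "k = l"
  using c_inj[of "Suc k" "Suc l"] assms by simp

lemma impact_at_collision:
  assumes "k < m"
  shows "impact n traj (I k) (J k) (c (Suc k))" and "impact n traj (J k) (I k) (c (Suc k))"
proof -
  have other: "\<not> touching traj l (I k) (c (Suc k)) \<and> \<not> touching traj l (J k) (c (Suc k))"
    if "l < n" "l \<noteq> I k" "l \<noteq> J k" for l
    using that assms collision_unique by (auto simp: touching_traj_iff I_J_less)
  have "(V k (J k) - V k (I k)) \<bullet> (X (Suc k) (J k) - X (Suc k) (I k)) < 0"
    using approach[OF assms] by (simp add: inner_diff_left inner_diff_right)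
  then show "impact n traj (I k) (J k) (c (Suc k))" "impact n traj (J k) (I k) (c (Suc k))"
    using other assms approach[OF assms]
    by (auto simp: impact_def touching_traj_iff I_J_less traj_at_collision velocities_at_collision)
qed

lemma impact_traj_cases:
  assumes "impact n traj i j t" "i < n" "j < n"
  obtains k where "k < m" "t = c (Suc k)" "i = I k \<and> j = J k \<or> i = J k \<and> j = I k"
  using assms by (auto simp: impact_def touching_traj_iff)

text \<open>Collisions of other balls may occur in the interval, so several rows can be involved;
  they all give ball \<open>i\<close> the same velocity.\<close>

lemma constant_velocity:
  assumes i: "i < n" and ab: "a < b" and free: "\<forall>t\<in>{a<..<b}. \<forall>j<n. \<not> impact n traj i j t"
  shows "rderiv (traj i) constant_on {a<..<b}"
proof -
  obtain k where k: "k \<le> m" "k = 0 \<or> c k \<le> a" "k = m \<or> a < c (Suc k)"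
    using phase_right[of a] by metis
  \<comment> \<open>Induction from the row in force at \<open>a\<close>: each later row starts with
    a collision inside the interval, which cannot involve ball \<open>i\<close>.\<close>
  have V_eq: "V l i = V k i" if "k \<le> l" "l \<le> m" "l = k \<or> c l < b" for l
    using that
  proof (induction l rule: dec_induct)
    case (step l)
    have "c (Suc l) \<in> {a<..<b}"
      using step k c_mono[of "Suc k" "Suc l"] by auto
    moreover have "l < m"
      using step by simp
    ultimately have "i \<noteq> I l" "i \<noteq> J l"
      using free impact_at_collision[of l] I_J_less(1,2)[of l] by metis+
    moreover have "l = k \<or> c l < b"
      using step.hyps step.prems c_less_Suc[OF \<open>l < m\<close>] by linarith
    then have "V l i = V k i"
      using step.IH \<open>l < m\<close> by linarith
    ultimately show ?case
      using V_Suc_other[OF \<open>l < m\<close> i] by simp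
  qed simp
  have "rderiv (traj i) t = V k i" if "t \<in> {a<..<b}" for t
  proof -
    obtain l where l: "l \<le> m" "l = 0 \<or> c l \<le> t" "l = m \<or> t < c (Suc l)"
      using phase_right[of t] by metis
    have "k \<le> l"
    proof (rule ccontr)
      assume "\<not> k \<le> l"
      then have "c (Suc l) \<le> c k"
        using k by (intro c_mono) auto
      then show False
        using l k that \<open>\<not> k \<le> l\<close> by auto
    qed
    moreover have "l = k \<or> c l < b"
      using l that \<open>k \<le> l\<close> by auto
    ultimately show ?thesis
      using rderiv_traj(2)[OF l i] V_eq[of l] l by simp
  qed
  then show ?thesis
    by (auto simp: constant_on_def)
qed

text \<open>Collision times are distinct, so at most one pair touches at any time. In a connected
  set of at least two balls each one touches some ball, hence the set lies within that pair.\<close>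

lemma not_simultaneous: "\<not> simultaneous_collision n traj t"
proof
  assume "simultaneous_collision n traj t"
  then obtain S where S: "S \<subseteq> {..<n}" "card S \<ge> 3"
    and conn: "\<forall>i\<in>S. \<forall>j\<in>S. (i, j) \<in> {(k, l). k \<in> S \<and> l \<in> S \<and> touching traj k l t}\<^sup>*"
    by (auto simp: simultaneous_collision_def)
  have partner: "\<exists>z<n. touching traj a z t" if a: "a \<in> S" for a
  proof -
    have "S \<noteq> {a}"
      using S by auto
    then obtain b where "b \<in> S" "b \<noteq> a"
      using a by blast
    then have "(a, b) \<in> {(k, l). k \<in> S \<and> l \<in> S \<and> touching traj k l t}\<^sup>*" "a \<noteq> b"
      using conn a by auto
    then show ?thesis
      by (cases rule: converse_rtranclE) (use S in auto)
  qed
  have "S \<noteq> {}" using S by auto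
  then obtain a z where "a \<in> S" "z < n" "touching traj a z t"
    using partner by blast
  moreover from this have "a < n"
    using S by auto
  ultimately obtain k where k: "k < m" "t = c (Suc k)"
    by (auto simp: touching_traj_iff)
  have "S \<subseteq> {I k, J k}"
  proof
    fix a assume a: "a \<in> S"
    then obtain z where "z < n" "touching traj a z t"
      using partner by blast
    then show "a \<in> {I k, J k}"
      using subsetD[OF S(1) a] k collision_unique by (auto simp: touching_traj_iff)
  qed
  then have "card S \<le> card {I k, J k}"
    by (intro card_mono) auto
  also have "\<dots> \<le> 2"
    by (simp add: card_insert_if)
  finally show False
    using S by simp
qed

lemma evolution_traj: "evolution n traj"
  unfolding evolution_def
proof (intro conjI allI impI)
  fix i t assume i: "i < n"
  show "continuous_on UNIV (traj i)"
    unfolding traj_def by (intro continuous_intros)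
  obtain k where "k \<le> m" "k = 0 \<or> c k \<le> t" "k = m \<or> t < c (Suc k)"
    using phase_right[of t] by metis
  from rderiv_traj(1)[OF this i] show "traj i differentiable at_right t"
    by (auto simp: differentiable_def has_vector_derivative_def)
  obtain k where "k \<le> m" "k = 0 \<or> c k < t" "k = m \<or> t \<le> c (Suc k)"
    using phase_left[of t] by metis
  from rderiv_before_traj(1)[OF this i] show "\<exists>l. (rderiv (traj i) \<longlongrightarrow> l) (at_left t)"
    by blast
next
  fix i j t assume ij: "i < n" "j < n" "i \<noteq> j"
  show "ball (traj i t) 1 \<inter> ball (traj j t) 1 = {}"
    using dist_traj_ge_2[OF ij] by (intro disjoint_ballI) simp
next
  fix i a b assume "i < n" "a < b \<and> (\<forall>t\<in>{a<..<b}. \<forall>j<n. \<not> impact n traj i j t)"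
  then show "rderiv (traj i) constant_on {a<..<b}"
    using constant_velocity by blast
next
  fix i j t assume ij: "i < n" "j < n" and imp: "impact n traj i j t"
  from impact_traj_cases[OF imp ij] obtain k where
    "k < m" "t = c (Suc k)" "i = I k \<and> j = J k \<or> i = J k \<and> j = I k" .
  then show "rderiv (traj i) t = rderiv_before (traj i) t -
      proj_along (traj i t - traj j t) (rderiv_before (traj i) t - rderiv_before (traj j) t)"
    using V_Suc_I[of k] V_Suc_J[of k] ij
    by (auto simp: velocities_at_collision traj_at_collision)
qed (rule not_simultaneous)

lemma collision_in_collisions:
  assumes k: "k < m"
  shows "(I k, J k, midpoint (X (Suc k) (I k)) (X (Suc k) (J k)), c (Suc k)) \<in> collisions n traj"
proof -
  note [simp] = I_J_less[OF k]
  \<comment> \<open>\<open>\<epsilon>\<close> is the least gap to another collision time, or 1 if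
    there is no other collision.\<close>
  define D where "D = (\<lambda>l. \<bar>c (Suc l) - c (Suc k)\<bar>) ` ({..<m} - {k})"
  define \<epsilon> where "\<epsilon> = (if D = {} then 1 else Min D)"
  have fin: "finite D" by (simp add: D_def)
  have "\<forall>x\<in>D. 0 < x"
    using k collision_unique by (force simp: D_def)
  then have "\<epsilon> > 0"
    using fin by (auto simp: \<epsilon>_def)
  moreover have "\<not> touching traj (I k) (J k) s"
    if "s \<in> {c (Suc k) - \<epsilon><..<c (Suc k)} \<union> {c (Suc k)<..<c (Suc k) + \<epsilon>}" for s
  proof
    assume "touching traj (I k) (J k) s"
    then obtain l where l: "l < m" "s = c (Suc l)"
      by (auto simp: touching_traj_iff)
    with that have "l \<noteq> k" by auto
    then have "\<bar>s - c (Suc k)\<bar> \<in> D"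
      using l by (auto simp: D_def)
    then have "\<epsilon> \<le> \<bar>s - c (Suc k)\<bar>"
      using fin by (auto simp: \<epsilon>_def)
    with that show False by auto
  qed
  moreover have "touching traj (I k) (J k) (c (Suc k))"
    using k by (auto simp: touching_traj_iff)
  moreover have "midpoint (X (Suc k) (I k)) (X (Suc k) (J k)) \<in>
      cball (X (Suc k) (I k)) 1 \<inter> cball (X (Suc k) (J k)) 1"
    using contact[OF k] by (simp add: dist_midpoint flip: dist_norm)
  \<comment> \<open>A nonzero momentum transfer means that both balls change velocity.\<close>
  moreover have "proj_along (X (Suc k) (I k) - X (Suc k) (J k)) (V k (I k) - V k (J k)) \<noteq> 0"
      "proj_along (X (Suc k) (J k) - X (Suc k) (I k)) (V k (J k) - V k (I k)) \<noteq> 0"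
    using contact[OF k] approach[OF k]
    by (auto simp: proj_along_def inner_diff_left inner_diff_right)
  ultimately show ?thesis
    using k V_Suc_I[OF k] V_Suc_J[OF k]
    by (auto simp: collisions_def velocities_at_collision traj_at_collision)
qed

lemma num_collisions_traj: "enat m \<le> num_collisions n traj"
proof -
  define f where "f k = (I k, J k, midpoint (X (Suc k) (I k)) (X (Suc k) (J k)), c (Suc k))" for k
  have "inj_on f {..<m}"
    using collision_unique by (auto simp: inj_on_def f_def)
  moreover have "f ` {..<m} \<subseteq> collisions n traj"
    using collision_in_collisions by (auto simp: f_def)
  ultimately have "finite (collisions n traj) \<Longrightarrow> m \<le> card (collisions n traj)"
    by (metis card_image card_lessThan card_mono)
  then show ?thesis
    by (simp add: num_collisions_def)
qed

end

section \<open>Isometric embeddings\<close>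

text \<open>If the centers are closer than 2, their midpoint lies in both open balls. Disjointness
  thus becomes a condition on distances, which isometries preserve.\<close>

lemma unit_balls_disjoint_iff:
  "ball x 1 \<inter> ball y 1 = {} \<longleftrightarrow> 2 \<le> dist x y" for x y :: "'a::euclidean_space"
proof
  assume *: "ball x 1 \<inter> ball y 1 = {}"
  show "2 \<le> dist x y"
  proof (rule ccontr)
    assume "\<not> 2 \<le> dist x y"
    then have "midpoint x y \<in> ball x 1 \<inter> ball y 1"
      by (simp add: dist_midpoint)
    with * show False by blast
  qed
qed (simp add: disjoint_ballI)

locale linear_isometry =
  fixes f :: "'a::euclidean_space \<Rightarrow> 'b::euclidean_space"
  assumes linear: "linear f" and norm_f [simp]: "norm (f v) = norm v"
begin

sublocale linear f
  by (rule linear)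

lemma inner_f [simp]: "f u \<bullet> f v = u \<bullet> v"
  by (simp add: dot_norm flip: add)

lemma dist_f [simp]: "dist (f u) (f v) = dist u v"
  by (simp add: dist_norm flip: diff)

lemma f_eq_iff [simp]: "f u = f v \<longleftrightarrow> u = v"
  using dist_f[of u v] by (metis dist_eq_0_iff)

lemma touching_f [simp]: "touching (\<lambda>i t. f (x i t)) i j t \<longleftrightarrow> touching x i j t"
  by (simp add: touching_def)

lemma proj_along_f: "proj_along (f u) (f v) = f (proj_along u v)"
  by (simp add: proj_along_def scale)

lemma has_right_derivative_f:
  assumes "g differentiable at_right t"
  shows "((\<lambda>t. f (g t)) has_vector_derivative f (rderiv g t)) (at_right t)"
proof -
  have "(g has_vector_derivative rderiv g t) (at_right t)"
    using assms unfolding rderiv_def by (simp add: vector_derivative_works)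
  then show ?thesis
    using bounded_linear.has_vector_derivative linear linear_conv_bounded_linear by blast
qed

lemma rderiv_f:
  assumes "g differentiable at_right t"
  shows "rderiv (\<lambda>t. f (g t)) t = f (rderiv g t)"
  using vector_derivative_within[OF _ has_right_derivative_f[OF assms]]
  by (simp add: rderiv_def)

lemma rderiv_tendsto_f:
  assumes diff: "\<And>t. g differentiable at_right t" and lim: "(rderiv g \<longlongrightarrow> l) (at_left t)"
  shows "(rderiv (\<lambda>t. f (g t)) \<longlongrightarrow> f l) (at_left t)"
proof -
  have "rderiv (\<lambda>t. f (g t)) = (\<lambda>t. f (rderiv g t))"
    using rderiv_f diff by blast
  then show ?thesis
    using linear lim bounded_linear.tendsto linear_conv_bounded_linear by metis
qed

text \<open>\<open>Lim\<close> is meaningful only where the limit exists, so commuting with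
  \<open>f\<close> rests on that existence.\<close>

lemma rderiv_before_f:
  assumes diff: "\<And>t. g differentiable at_right t" and lim: "\<exists>l. (rderiv g \<longlongrightarrow> l) (at_left t)"
  shows "rderiv_before (\<lambda>t. f (g t)) t = f (rderiv_before g t)"
proof -
  obtain l where l: "(rderiv g \<longlongrightarrow> l) (at_left t)"
    using lim by blast
  show ?thesis
    using tendsto_Lim[OF _ l] tendsto_Lim[OF _ rderiv_tendsto_f[OF diff l]]
    by (simp add: rderiv_before_def)
qed

section \<open>Transport of an evolution along an isometry\<close>

context
  fixes n :: nat and x :: "nat \<Rightarrow> real \<Rightarrow> 'a"
  assumes evol: "evolution n x"
begin

lemma differentiable_x: "i < n \<Longrightarrow> x i differentiable at_right t"
  and left_limit_x: "i < n \<Longrightarrow> \<exists>l. (rderiv (x i) \<longlongrightarrow> l) (at_left t)"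
  using evol by (auto simp: evolution_def)

lemma rderiv_x:
  assumes "i < n"
  shows "rderiv (\<lambda>t. f (x i t)) t = f (rderiv (x i) t)"
    and "rderiv_before (\<lambda>t. f (x i t)) t = f (rderiv_before (x i) t)"
  using assms by (auto intro!: rderiv_f rderiv_before_f differentiable_x left_limit_x)

lemma impact_f:
  assumes "i < n" "j < n"
  shows "impact n (\<lambda>i t. f (x i t)) i j t \<longleftrightarrow> impact n x i j t"
  using assms by (simp add: impact_def rderiv_x flip: diff)

lemma evolution_f: "evolution n (\<lambda>i t. f (x i t))"
  unfolding evolution_def
proof (intro conjI allI impI)
  fix i t assume i: "i < n"
  have "continuous_on UNIV (x i)"
    using evol i by (simp add: evolution_def)
  then show "continuous_on UNIV (\<lambda>t. f (x i t))"
    by (rule linear_continuous_on_compose[OF _ linear])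
  show "(\<lambda>t. f (x i t)) differentiable at_right t"
    using has_right_derivative_f[OF differentiable_x[OF i]]
    by (auto simp: differentiable_def has_vector_derivative_def)
  show "\<exists>l. (rderiv (\<lambda>t. f (x i t)) \<longlongrightarrow> l) (at_left t)"
    using rderiv_tendsto_f[OF differentiable_x[OF i]] left_limit_x[OF i] by blast
next
  fix i j t assume "i < n" "j < n" "i \<noteq> j"
  then show "ball (f (x i t)) 1 \<inter> ball (f (x j t)) 1 = {}"
    using evol by (simp add: unit_balls_disjoint_iff evolution_def)
next
  fix i a b
  assume i: "i < n"
    and ab: "a < b \<and> (\<forall>t\<in>{a<..<b}. \<forall>j<n. \<not> impact n (\<lambda>i t. f (x i t)) i j t)"
  then have "rderiv (x i) constant_on {a<..<b}"
    using evol by (auto simp: evolution_def impact_f)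
  then show "rderiv (\<lambda>t. f (x i t)) constant_on {a<..<b}"
    using i by (auto simp: constant_on_def rderiv_x)
next
  fix i j t assume "i < n" "j < n" "impact n (\<lambda>i t. f (x i t)) i j t"
  then show "rderiv (\<lambda>t. f (x i t)) t = rderiv_before (\<lambda>t. f (x i t)) t -
      proj_along (f (x i t) - f (x j t))
        (rderiv_before (\<lambda>t. f (x i t)) t - rderiv_before (\<lambda>t. f (x j t)) t)"
    using evol by (simp add: evolution_def impact_f rderiv_x proj_along_f flip: diff)
next
  fix t
  have "simultaneous_collision n (\<lambda>i t. f (x i t)) t \<longleftrightarrow> simultaneous_collision n x t"
    by (simp add: simultaneous_collision_def)
  then show "\<not> simultaneous_collision n (\<lambda>i t. f (x i t)) t"
    using evol by (simp add: evolution_def)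
qed

text \<open>Mapping the point of tangency along with the balls injects the collisions of
  \<open>x\<close> into those of its image.\<close>

lemma num_collisions_f: "num_collisions n x \<le> num_collisions n (\<lambda>i t. f (x i t))"
proof -
  define g where "g = (\<lambda>(i::nat, j::nat, y, t::real). (i, j, f y, t))"
  have inj: "inj_on g (collisions n x)"
    by (auto simp: inj_on_def g_def)
  have sub: "g ` collisions n x \<subseteq> collisions n (\<lambda>i t. f (x i t))"
    by (auto simp: g_def collisions_def rderiv_x)
  have "finite (collisions n x) \<and> card (collisions n x) \<le> card (collisions n (\<lambda>i t. f (x i t)))"
    if "finite (collisions n (\<lambda>i t. f (x i t)))"
    using that inj sub by (metis card_inj_on_le inj_on_finite)
  then show ?thesis
    by (auto simp: num_collisions_def)
qed

end

end

lemma K_mono: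
  assumes "CARD('c::finite) \<le> CARD('d::finite)"
  shows "K n TYPE('c) \<le> K n TYPE('d)"
proof -
  have "dim (UNIV :: (real ^ 'c) set) \<le> dim (UNIV :: (real ^ 'd) set)"
    using assms by simp
  then obtain f :: "real ^ 'c \<Rightarrow> real ^ 'd" where "linear f" "\<And>x. norm (f x) = norm x"
    by (rule isometry_subset_subspace[OF subspace_UNIV subspace_UNIV]) auto
  then interpret linear_isometry f
    by (rule linear_isometry.intro)
  show ?thesis
    unfolding K_def
  proof (rule SUP_mono)
    fix x :: "nat \<Rightarrow> real \<Rightarrow> real ^ 'c" assume "x \<in> {x. evolution n x}"
    then show "\<exists>y\<in>{y :: nat \<Rightarrow> real \<Rightarrow> real ^ 'd. evolution n y}.
        num_collisions n x \<le> num_collisions n y"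
      using evolution_f num_collisions_f by blast
  qed
qed

section \<open>Integer data in the plane\<close>

text \<open>
  A ball \<open>(x, y, a, b)\<close> has center \<open>(x, y) / R\<close> and velocity \<open>(a, b) / R\<close>, where \<open>R\<close> is a common
  denominator. The event \<open>(\<tau>, i, j, p, q)\<close> stands for a free flight of duration \<open>\<tau>\<close> followed by a
  collision in which ball \<open>i\<close> passes the momentum \<open>(p, q) / R\<close> on to ball \<open>j\<close>.
\<close>

type_synonym ball = "int \<times> int \<times> int \<times> int"
type_synonym event = "int \<times> nat \<times> nat \<times> int \<times> int"

definition rel :: "ball list \<Rightarrow> nat \<Rightarrow> nat \<Rightarrow> ball" where
  "rel st k l = (case (st ! k, st ! l) of ((x, y, a, b), (x', y', a', b')) \<Rightarrow>
     (x - x', y - y', a - a', b - b'))"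

fun sqdist :: "ball \<Rightarrow> int" where
  "sqdist (x, y, a, b) = x * x + y * y"

fun drift :: "ball \<Rightarrow> int" where
  "drift (x, y, a, b) = x * a + y * b"

text \<open>By Lagrange's identity in the plane, the squared cross product is
  \<open>(d \<bullet> d) * (w \<bullet> w) - (d \<bullet> w)\<^sup>2\<close>; this is
  \<open>misses\<close> with the scale \<open>R\<close> cleared.\<close>

fun int_misses :: "int \<Rightarrow> ball \<Rightarrow> bool" where
  "int_misses R (x, y, a, b) \<longleftrightarrow> 4 * (R * R) * (a * a + b * b) < (x * b - y * a) * (x * b - y * a)"

text \<open>Bounded lists replace quantifiers so that the check can be evaluated.\<close>

definition all_pairs :: "nat \<Rightarrow> (nat \<Rightarrow> nat \<Rightarrow> bool) \<Rightarrow> bool" where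
  "all_pairs n P \<longleftrightarrow> list_all (\<lambda>l. list_all (\<lambda>k. P k l) [0..<l]) [0..<n]"

fun advance :: "int \<Rightarrow> ball \<Rightarrow> ball" where
  "advance \<tau> (x, y, a, b) = (x + \<tau> * a, y + \<tau> * b, a, b)"

fun kick :: "int \<Rightarrow> int \<Rightarrow> ball \<Rightarrow> ball" where
  "kick p q (x, y, a, b) = (x, y, a + p, b + q)"

fun step :: "ball list \<Rightarrow> event \<Rightarrow> ball list" where
  "step st (\<tau>, i, j, p, q) =
     (let st' = map (advance \<tau>) st in st'[i := kick (- p) (- q) (st' ! i), j := kick p q (st' ! j)])"

text \<open>The last two conjuncts say that \<open>(p, q)\<close> is the projection of the relative velocity onto
  the line of centers, which has length \<open>2 R\<close> at contact.\<close>

fun impulse_ok :: "int \<Rightarrow> int \<Rightarrow> int \<Rightarrow> ball \<Rightarrow> bool" where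
  "impulse_ok R p q (x, y, a, b) \<longleftrightarrow>
     x * x + y * y = 4 * (R * R) \<and> x * a + y * b < 0 \<and>
     4 * (R * R) * p = (x * a + y * b) * x \<and> 4 * (R * R) * q = (x * a + y * b) * y"

text \<open>The conditionals stand for disjunctions and let evaluation skip the later tests once an
  earlier one succeeds.\<close>

fun step_ok :: "int \<Rightarrow> nat \<Rightarrow> ball list \<Rightarrow> event \<Rightarrow> bool" where
  "step_ok R n st (\<tau>, i, j, p, q) \<longleftrightarrow> 0 < \<tau> \<and> i < j \<and> j < n \<and>
     (let st' = map (advance \<tau>) st in
        impulse_ok R p q (rel st' i j) \<and>
        all_pairs n (\<lambda>k l.
          (if drift (rel st' k l) < 0 then True
           else if 0 < drift (rel st k l) then True else int_misses R (rel st k l)) \<and>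
          (if k = i \<and> l = j then True else 4 * (R * R) < sqdist (rel st' k l))))"

definition start_ok :: "int \<Rightarrow> nat \<Rightarrow> ball list \<Rightarrow> bool" where
  "start_ok R n st \<longleftrightarrow> all_pairs n (\<lambda>k l. 4 * (R * R) < sqdist (rel st k l) \<and>
     (if drift (rel st k l) < 0 then True else int_misses R (rel st k l)))"

definition end_ok :: "int \<Rightarrow> nat \<Rightarrow> ball list \<Rightarrow> bool" where
  "end_ok R n st \<longleftrightarrow> all_pairs n (\<lambda>k l.
     (if 0 < drift (rel st k l) then True else int_misses R (rel st k l)))"

fun run_ok :: "int \<Rightarrow> nat \<Rightarrow> ball list \<Rightarrow> event list \<Rightarrow> bool" where
  "run_ok R n st [] \<longleftrightarrow> end_ok R n st"
| "run_ok R n st (e # es) \<longleftrightarrow> step_ok R n st e \<and> run_ok R n (step st e) es"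

definition valid_run :: "int \<Rightarrow> nat \<Rightarrow> ball list \<Rightarrow> event list \<Rightarrow> bool" where
  "valid_run R n st es \<longleftrightarrow> 0 < R \<and> length st = n \<and> start_ok R n st \<and> run_ok R n st es"

lemma all_pairs_iff: "all_pairs n P \<longleftrightarrow> (\<forall>k l. k < l \<longrightarrow> l < n \<longrightarrow> P k l)"
  by (auto simp: all_pairs_def list_all_iff)

definition state :: "ball list \<Rightarrow> event list \<Rightarrow> nat \<Rightarrow> ball list" where
  "state st es k = foldl step st (take k es)"

lemma state_0: "state st es 0 = st"
  by (simp add: state_def)

lemma state_Suc: "k < length es \<Longrightarrow> state st es (Suc k) = step (state st es k) (es ! k)"
  by (simp add: state_def take_Suc_conv_app_nth)

lemma length_step: "length (step st e) = length st"
  by (cases e) (simp add: Let_def)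

lemma length_state: "k \<le> length es \<Longrightarrow> length (state st es k) = length st"
  by (induction k) (simp_all add: state_0 state_Suc length_step)

lemma run_ok_step:
  assumes "run_ok R n st es" "k < length es"
  shows "step_ok R n (state st es k) (es ! k)"
  using assms
proof (induction es arbitrary: st k)
  case (Cons e es)
  then show ?case by (cases k) (auto simp: state_def)
qed simp

lemma run_ok_end: "run_ok R n st es \<Longrightarrow> end_ok R n (state st es (length es))"
  by (induction es arbitrary: st) (auto simp: state_def)

section \<open>From integer checks to vectors in the plane\<close>

definition vec2 :: "real \<Rightarrow> real \<Rightarrow> real ^ 2" where
  "vec2 x y = vector [x, y]"

lemma inner_vec2: "vec2 x y \<bullet> vec2 x' y' = x * x' + y * y'"
  by (simp add: vec2_def inner_vec_def sum_2)

lemma vec2_arith: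
  "vec2 x y + vec2 x' y' = vec2 (x + x') (y + y')"
  "vec2 x y - vec2 x' y' = vec2 (x - x') (y - y')"
  "s *\<^sub>R vec2 x y = vec2 (s * x) (s * y)"
  by (simp_all add: vec2_def vec_eq_iff forall_2)

fun pos :: "int \<Rightarrow> ball \<Rightarrow> real ^ 2" where
  "pos R (x, y, a, b) = vec2 (of_int x / of_int R) (of_int y / of_int R)"

fun vel :: "int \<Rightarrow> ball \<Rightarrow> real ^ 2" where
  "vel R (x, y, a, b) = vec2 (of_int a / of_int R) (of_int b / of_int R)"

lemma pos_vel_diff:
  "pos R (st ! k) - pos R (st ! l) = pos R (rel st k l)"
  "vel R (st ! k) - vel R (st ! l) = vel R (rel st k l)"
  by (simp_all add: rel_def vec2_arith diff_divide_distrib split: prod.splits)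

lemma pos_vel_advance:
  "pos R (advance \<tau> z) = pos R z + of_int \<tau> *\<^sub>R vel R z"
  "vel R (advance \<tau> z) = vel R z"
  by (cases z; simp add: vec2_arith add_divide_distrib)+

lemma pos_vel_kick:
  "pos R (kick p q z) = pos R z"
  "vel R (kick p q z) = vel R z + vec2 (of_int p / of_int R) (of_int q / of_int R)"
  by (cases z; simp add: vec2_arith add_divide_distrib)+

context
  fixes R :: int
  assumes R: "0 < R"
begin

lemma inner_pos_vel: "pos R z \<bullet> vel R z = of_int (drift z) / (of_int R)\<^sup>2"
  by (cases z) (simp add: inner_vec2 add_divide_distrib power2_eq_square)

lemma inner_pos_vel_neg: "pos R z \<bullet> vel R z < 0 \<longleftrightarrow> drift z < 0"
  and inner_pos_vel_pos: "0 < pos R z \<bullet> vel R z \<longleftrightarrow> 0 < drift z"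
  using R by (simp_all add: inner_pos_vel divide_less_0_iff zero_less_divide_iff)

lemma inner_pos: "pos R z \<bullet> pos R z = of_int (sqdist z) / (of_int R)\<^sup>2"
  by (cases z) (simp add: inner_vec2 add_divide_distrib power2_eq_square)

lemma norm_pos_gt_2:
  assumes "4 * (R * R) < sqdist z"
  shows "2 < norm (pos R z)"
proof -
  have "real_of_int (4 * (R * R)) < of_int (sqdist z)"
    using assms by (simp only: of_int_less_iff)
  then show ?thesis
    using R by (simp add: norm_gt_2_iff inner_pos less_divide_eq power2_eq_square)
qed

lemma misses_pos_vel:
  assumes "int_misses R z"
  shows "misses (pos R z) (vel R z)"
proof -
  obtain x y a b where z: "z = (x, y, a, b)" by (cases z)
  define D W S r where "D = real_of_int (x * a + y * b)" and "W = real_of_int (a * a + b * b)"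
    and "S = real_of_int (x * x + y * y)" and "r = (real_of_int R)\<^sup>2"
  have r: "0 < r" using R by (simp add: r_def)
  have "(x * a + y * b) * (x * a + y * b) + 4 * (R * R) * (a * a + b * b) <
      (x * x + y * y) * (a * a + b * b)"
    using assms by (simp add: z algebra_simps)
  then have "real_of_int ((x * a + y * b) * (x * a + y * b) + 4 * (R * R) * (a * a + b * b)) <
      of_int ((x * x + y * y) * (a * a + b * b))"
    by (simp only: of_int_less_iff)
  then have *: "D\<^sup>2 + 4 * r * W < S * W"
    by (simp only: of_int_add of_int_mult of_int_numeral D_def W_def S_def r_def power2_eq_square)
  have inner: "pos R z \<bullet> vel R z = D / r" "pos R z \<bullet> pos R z = S / r" "vel R z \<bullet> vel R z = W / r"
    by (simp_all add: z inner_vec2 D_def S_def W_def r_def add_divide_distrib power2_eq_square)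
  have "(D / r)\<^sup>2 + 4 * (W / r) = (D\<^sup>2 + 4 * r * W) / r\<^sup>2"
    using r by (simp add: power_divide add_divide_distrib power2_eq_square)
  also have "\<dots> < (S * W) / r\<^sup>2"
    using r * by (intro divide_strict_right_mono) auto
  also have "\<dots> = S / r * (W / r)"
    by (simp add: power2_eq_square)
  finally show ?thesis
    unfolding misses_def inner .
qed

lemma impulse_ok_imp:
  assumes "impulse_ok R p q z"
  shows "norm (pos R z) = 2" and "pos R z \<bullet> vel R z < 0"
    and "proj_along (pos R z) (vel R z) = vec2 (of_int p / of_int R) (of_int q / of_int R)"
proof -
  obtain x y a b where z: "z = (x, y, a, b)" by (cases z)
  have sq: "sqdist z = 4 * (R * R)" and dr: "drift z < 0"
    and pq: "4 * (R * R) * p = drift z * x" "4 * (R * R) * q = drift z * y"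
    using assms by (simp_all add: z)
  have "pos R z \<bullet> pos R z = 4"
    using R by (simp add: inner_pos sq power2_eq_square)
  then show n: "norm (pos R z) = 2"
    by (simp add: norm_eq_sqrt_inner)
  show "pos R z \<bullet> vel R z < 0"
    using dr by (simp add: inner_pos_vel_neg)
  have "real_of_int (4 * (R * R) * p) = of_int (drift z * x)"
    "real_of_int (4 * (R * R) * q) = of_int (drift z * y)"
    using pq by presburger+
  then have *: "of_int (drift z) * real_of_int x = 4 * (of_int R)\<^sup>2 * of_int p"
    "of_int (drift z) * real_of_int y = 4 * (of_int R)\<^sup>2 * of_int q"
    by (simp_all add: power2_eq_square)
  \<comment> \<open>At contact the squared length is 4, which leaves \<open>4 * R\<^sup>2\<close> as
    the denominator cleared in \<open>impulse_ok\<close>.\<close>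
  have coef: "(vel R z \<bullet> pos R z) / (norm (pos R z))\<^sup>2 = of_int (drift z) / (4 * (of_int R)\<^sup>2)"
    by (simp add: n inner_commute[of "vel R z"] inner_pos_vel)
  show "proj_along (pos R z) (vel R z) = vec2 (of_int p / of_int R) (of_int q / of_int R)"
    using * R unfolding proj_along_def coef by (simp add: z vec2_arith del: drift.simps)
qed

end

lemma proj_along_minus: "proj_along (- w) (- z) = - proj_along w z"
  by (simp add: proj_along_def)

text \<open>The conclusions are the conditions of \<open>flight_table\<close> on one flight and the
  collision ending it.\<close>

lemma step_ok_imp:
  assumes R: "0 < R" and len: "length st = n" and ok: "step_ok R n st (\<tau>, i, j, p, q)"
  defines "st' \<equiv> step st (\<tau>, i, j, p, q)"
  shows "0 < \<tau>" and "i < j" and "j < n"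
    and "k < n \<Longrightarrow> pos R (st' ! k) = pos R (st ! k) + of_int \<tau> *\<^sub>R vel R (st ! k)"
    and "norm (pos R (st' ! i) - pos R (st' ! j)) = 2"
    and "(vel R (st ! i) - vel R (st ! j)) \<bullet> (pos R (st' ! i) - pos R (st' ! j)) < 0"
    and "vel R (st' ! i) = vel R (st ! i) -
      proj_along (pos R (st' ! i) - pos R (st' ! j)) (vel R (st ! i) - vel R (st ! j))"
    and "vel R (st' ! j) = vel R (st ! j) -
      proj_along (pos R (st' ! j) - pos R (st' ! i)) (vel R (st ! j) - vel R (st ! i))"
    and "k < n \<Longrightarrow> k \<noteq> i \<Longrightarrow> k \<noteq> j \<Longrightarrow> vel R (st' ! k) = vel R (st ! k)"
    and "k < l \<Longrightarrow> l < n \<Longrightarrow> (k, l) \<noteq> (i, j) \<Longrightarrow> 2 < norm (pos R (st' ! k) - pos R (st' ! l))"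
    and "k < l \<Longrightarrow> l < n \<Longrightarrow>
      misses (pos R (st ! k) - pos R (st ! l)) (vel R (st ! k) - vel R (st ! l)) \<or>
      0 < (pos R (st ! k) - pos R (st ! l)) \<bullet> (vel R (st ! k) - vel R (st ! l)) \<or>
      (pos R (st' ! k) - pos R (st' ! l)) \<bullet> (vel R (st ! k) - vel R (st ! l)) < 0"
proof -
  \<comment> \<open>The state just before the kick: it has the positions of \<open>st'\<close> and
    the velocities of \<open>st\<close>, so \<open>rel su\<close> pairs new positions with old
    velocities.\<close>
  define su where "su = map (advance \<tau>) st"
  have if_iff: "(if P then True else Q) \<longleftrightarrow> P \<or> Q" for P Q
    by simp
  note ok' = ok[unfolded step_ok.simps Let_def all_pairs_iff if_iff, folded su_def]
  have basic: "0 < \<tau>" "i < j" "j < n" and imp: "impulse_ok R p q (rel su i j)"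
    using ok' by blast+
  have pairs: "\<And>k l. k < l \<Longrightarrow> l < n \<Longrightarrow>
      (int_misses R (rel st k l) \<or> 0 < drift (rel st k l) \<or> drift (rel su k l) < 0) \<and>
      ((k, l) \<noteq> (i, j) \<longrightarrow> 4 * (R * R) < sqdist (rel su k l))"
    using ok' by blast
  show "0 < \<tau>" "i < j" "j < n"
    by (fact basic)+
  have st': "st' = su[i := kick (- p) (- q) (su ! i), j := kick p q (su ! j)]"
    by (simp add: st'_def su_def Let_def)
  have len_su: "length su = n"
    by (simp add: su_def len)
  have ij: "i < n" "j < n" "i \<noteq> j"
    using basic by auto
  have vel_su: "vel R (su ! k) = vel R (st ! k)" if "k < n" for k
    using that len by (simp add: su_def pos_vel_advance)
  have pos_st': "pos R (st' ! k) = pos R (su ! k)" if "k < n" for k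
    using that ij len_su by (simp add: st' nth_list_update pos_vel_kick)
  show "pos R (st' ! k) = pos R (st ! k) + of_int \<tau> *\<^sub>R vel R (st ! k)" if "k < n" for k
    using that len by (simp add: pos_st' su_def pos_vel_advance)
  have pos_rel: "pos R (st' ! k) - pos R (st' ! l) = pos R (rel su k l)" if "k < n" "l < n" for k l
    using that by (simp add: pos_st' pos_vel_diff)
  have vel_rel: "vel R (st ! k) - vel R (st ! l) = vel R (rel su k l)" if "k < n" "l < n" for k l
    using that by (simp add: vel_su flip: pos_vel_diff)
  note impulse = impulse_ok_imp[OF R imp]
  show "norm (pos R (st' ! i) - pos R (st' ! j)) = 2"
    using impulse(1) ij by (simp add: pos_rel)
  show "(vel R (st ! i) - vel R (st ! j)) \<bullet> (pos R (st' ! i) - pos R (st' ! j)) < 0"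
    using impulse(2) ij by (simp add: pos_rel vel_rel inner_commute)
  have neg: "vec2 (- x) (- y) = - vec2 x y" for x y
    using vec2_arith(3)[of "- 1" x y] by simp
  have proj: "proj_along (pos R (st' ! i) - pos R (st' ! j)) (vel R (st ! i) - vel R (st ! j)) =
      vec2 (of_int p / of_int R) (of_int q / of_int R)"
    using ij by (simp add: pos_rel vel_rel impulse(3))
  have "vel R (st' ! i) = vel R (st ! i) - vec2 (of_int p / of_int R) (of_int q / of_int R)"
    using ij len_su by (simp add: st' pos_vel_kick vel_su neg)
  then show "vel R (st' ! i) = vel R (st ! i) -
      proj_along (pos R (st' ! i) - pos R (st' ! j)) (vel R (st ! i) - vel R (st ! j))"
    unfolding proj .
  have "vel R (st' ! j) = vel R (st ! j) + vec2 (of_int p / of_int R) (of_int q / of_int R)"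
    using ij len_su by (simp add: st' pos_vel_kick vel_su)
  moreover have "proj_along (pos R (st' ! j) - pos R (st' ! i)) (vel R (st ! j) - vel R (st ! i)) =
      - proj_along (pos R (st' ! i) - pos R (st' ! j)) (vel R (st ! i) - vel R (st ! j))"
    using proj_along_minus[of "pos R (st' ! i) - pos R (st' ! j)" "vel R (st ! i) - vel R (st ! j)"]
    by simp
  ultimately show "vel R (st' ! j) = vel R (st ! j) -
      proj_along (pos R (st' ! j) - pos R (st' ! i)) (vel R (st ! j) - vel R (st ! i))"
    unfolding proj by simp
  show "vel R (st' ! k) = vel R (st ! k)" if "k < n" "k \<noteq> i" "k \<noteq> j"
    using that by (simp add: st' vel_su)
  show "2 < norm (pos R (st' ! k) - pos R (st' ! l))" if "k < l" "l < n" "(k, l) \<noteq> (i, j)"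
    using pairs[of k l] that R by (simp add: pos_rel norm_pos_gt_2)
  show "misses (pos R (st ! k) - pos R (st ! l)) (vel R (st ! k) - vel R (st ! l)) \<or>
      0 < (pos R (st ! k) - pos R (st ! l)) \<bullet> (vel R (st ! k) - vel R (st ! l)) \<or>
      (pos R (st' ! k) - pos R (st' ! l)) \<bullet> (vel R (st ! k) - vel R (st ! l)) < 0"
    if "k < l" "l < n"
  proof -
    have "(pos R (st' ! k) - pos R (st' ! l)) \<bullet> (vel R (st ! k) - vel R (st ! l)) < 0 \<longleftrightarrow>
        drift (rel su k l) < 0"
      using that R by (simp add: pos_rel vel_rel inner_pos_vel_neg)
    then show ?thesis
      using pairs[OF that] R by (auto simp: pos_vel_diff inner_pos_vel_pos misses_pos_vel)
  qed
qed

text \<open>Row \<open>k\<close> is the state after \<open>k\<close> events, and its time is the sum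
  of their durations, so the table starts at time 0.\<close>

lemma flight_table_state:
  assumes "valid_run R n st es"
  shows "flight_table n (length es) (\<lambda>k. of_int (sum_list (map fst (take k es))))
    (\<lambda>k i. pos R (state st es k ! i)) (\<lambda>k i. vel R (state st es k ! i))
    (\<lambda>k. fst (snd (es ! k))) (\<lambda>k. fst (snd (snd (es ! k))))"
proof -
  have R: "0 < R" and len: "length st = n" and start: "start_ok R n st" and run: "run_ok R n st es"
    using assms by (auto simp: valid_run_def)
  have stop: "end_ok R n (state st es (length es))"
    using run by (rule run_ok_end)
  have time: "sum_list (map fst (take (Suc k) es)) - sum_list (map fst (take k es)) = fst (es ! k)"
    if "k < length es" for k
    using that by (simp add: take_Suc_conv_app_nth)
  show ?thesis
  proof
    fix k assume k: "k < length es"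
    obtain \<tau> i j p q where e: "es ! k = (\<tau>, i, j, p, q)"
      by (metis prod_cases5)
    have "length (state st es k) = n"
      using k len by (simp add: length_state)
    note ok = step_ok_imp[OF R this run_ok_step[OF run k, unfolded e]]
    note e' = e state_Suc[OF k, unfolded e]
    have time': "real_of_int (sum_list (map fst (take (Suc k) es))) =
        of_int (sum_list (map fst (take k es))) + of_int \<tau>"
      using time[OF k] e by simp
    show "real_of_int (sum_list (map fst (take k es))) < of_int (sum_list (map fst (take (Suc k) es)))"
      using ok(1) unfolding time' by simp
    show "pos R (state st es (Suc k) ! i) = pos R (state st es k ! i) +
        (real_of_int (sum_list (map fst (take (Suc k) es))) -
          real_of_int (sum_list (map fst (take k es)))) *\<^sub>R vel R (state st es k ! i)"
      if "i < n" for i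
      using ok(4)[OF that] unfolding time' e' by simp
    show "fst (snd (es ! k)) < fst (snd (snd (es ! k))) \<and> fst (snd (snd (es ! k))) < n"
      using ok(2,3) unfolding e' by simp
    show "norm (pos R (state st es (Suc k) ! fst (snd (es ! k))) -
        pos R (state st es (Suc k) ! fst (snd (snd (es ! k))))) = 2"
      using ok(5) unfolding e' by simp
    show "(vel R (state st es k ! fst (snd (es ! k))) - vel R (state st es k ! fst (snd (snd (es ! k))))) \<bullet>
        (pos R (state st es (Suc k) ! fst (snd (es ! k))) -
         pos R (state st es (Suc k) ! fst (snd (snd (es ! k))))) < 0"
      using ok(6) unfolding e' by simp
    show "vel R (state st es (Suc k) ! fst (snd (es ! k))) =
        vel R (state st es k ! fst (snd (es ! k))) -
        proj_along (pos R (state st es (Suc k) ! fst (snd (es ! k))) -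
            pos R (state st es (Suc k) ! fst (snd (snd (es ! k)))))
          (vel R (state st es k ! fst (snd (es ! k))) - vel R (state st es k ! fst (snd (snd (es ! k)))))"
      using ok(7) unfolding e' by simp
    show "vel R (state st es (Suc k) ! fst (snd (snd (es ! k)))) =
        vel R (state st es k ! fst (snd (snd (es ! k)))) -
        proj_along (pos R (state st es (Suc k) ! fst (snd (snd (es ! k)))) -
            pos R (state st es (Suc k) ! fst (snd (es ! k))))
          (vel R (state st es k ! fst (snd (snd (es ! k)))) - vel R (state st es k ! fst (snd (es ! k))))"
      using ok(8) unfolding e' by simp
    show "vel R (state st es (Suc k) ! i) = vel R (state st es k ! i)"
      if "i < n" "i \<noteq> fst (snd (es ! k))" "i \<noteq> fst (snd (snd (es ! k)))" for i
      using ok(9)[of i] that unfolding e' by simp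
    show "2 < norm (pos R (state st es (Suc k) ! i) - pos R (state st es (Suc k) ! j))"
      if "i < j" "j < n" "(i, j) \<noteq> (fst (snd (es ! k)), fst (snd (snd (es ! k))))" for i j
      using ok(10)[of i j] that unfolding e' by simp
    show "misses (pos R (state st es k ! i) - pos R (state st es k ! j))
          (vel R (state st es k ! i) - vel R (state st es k ! j)) \<or>
        0 < (pos R (state st es k ! i) - pos R (state st es k ! j)) \<bullet>
          (vel R (state st es k ! i) - vel R (state st es k ! j)) \<or>
        (pos R (state st es (Suc k) ! i) - pos R (state st es (Suc k) ! j)) \<bullet>
          (vel R (state st es k ! i) - vel R (state st es k ! j)) < 0"
      if "i < j" "j < n" for i j
      using ok(11)[OF that] unfolding e' .
  next
    fix i j assume ij: "i < j" "j < n"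
    show "2 < norm (pos R (state st es 0 ! i) - pos R (state st es 0 ! j))"
      using start ij R by (simp add: start_ok_def all_pairs_iff state_0 pos_vel_diff norm_pos_gt_2)
    show "misses (pos R (state st es 0 ! i) - pos R (state st es 0 ! j))
          (vel R (state st es 0 ! i) - vel R (state st es 0 ! j)) \<or>
        (pos R (state st es 0 ! i) - pos R (state st es 0 ! j)) \<bullet>
          (vel R (state st es 0 ! i) - vel R (state st es 0 ! j)) < 0"
      using start ij R
      by (auto simp: start_ok_def all_pairs_iff state_0 pos_vel_diff inner_pos_vel_neg misses_pos_vel)
    show "misses (pos R (state st es (length es) ! i) - pos R (state st es (length es) ! j))
          (vel R (state st es (length es) ! i) - vel R (state st es (length es) ! j)) \<or>
        0 < (pos R (state st es (length es) ! i) - pos R (state st es (length es) ! j)) \<bullet>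
          (vel R (state st es (length es) ! i) - vel R (state st es (length es) ! j))"
      using stop ij R
      by (auto simp: end_ok_def all_pairs_iff pos_vel_diff inner_pos_vel_pos misses_pos_vel)
  qed
qed

theorem valid_run_imp_K_ge:
  assumes "valid_run R n st es"
  shows "enat (length es) \<le> K n TYPE(2)"
proof -
  interpret flight_table n "length es" "\<lambda>k. of_int (sum_list (map fst (take k es)))"
    "\<lambda>k i. pos R (state st es k ! i)" "\<lambda>k i. vel R (state st es k ! i)"
    "\<lambda>k. fst (snd (es ! k))" "\<lambda>k. fst (snd (snd (es ! k)))"
    using assms by (rule flight_table_state)
  show ?thesis
    unfolding K_def using evolution_traj
    by (intro SUP_upper2[where i = traj] num_collisions_traj) simp
qed

section \<open>Evolutions of four, five and six balls\<close>

text \<open>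
  The balls \<open>A, B, C, \<dots>\<close> are numbered \<open>0, 1, 2, \<dots>\<close>. With \<open>A\<close> meeting \<open>B\<close> at speed \<open>1\<close> along the
  normal \<open>(3/5, -4/5)\<close>, \<open>(3/5, -4/5)\<close>, \<open>(20/29, -21/29)\<close> for \<open>n = 4, 5, 6\<close>, the remaining
  normals and the velocities of \<open>B, C, \<dots>\<close> before \<open>A\<close> arrives were chosen as follows, and everything
  else was computed from them.
  \<^item> \<open>n = 4\<close>: \<open>BC (63/65, 16/65)\<close>, \<open>CD (24/25, -7/25)\<close>, \<open>AC (0, -1)\<close>, velocities \<open>0, 1/80, 3/80\<close>
  \<^item> \<open>n = 5\<close>: \<open>BC (12/13, 5/13)\<close>, \<open>CD (63/65, -16/65)\<close>, \<open>DE (63/65, 16/65)\<close>, \<open>AC (3/5, -4/5)\<close>,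
    velocities \<open>0, 1/20, 1/10, 3/20\<close>
  \<^item> \<open>n = 6\<close>: \<open>BC (12/13, 5/13)\<close>, \<open>CD (220/221, -21/221)\<close>, \<open>DE (60/61, 11/61)\<close>,
    \<open>EF (117/125, -44/125)\<close>, \<open>AC (4/5, -3/5)\<close>, velocities \<open>0, 1/20, 1/10, 3/20, 1/5\<close>

  The time unit and \<open>R\<close> clear all denominators.
\<close>

lemma valid_run_4:
  "valid_run 5104737897610000 4
    [(- 332532422455493325, 260246003134256100, 46289232600, - 35373063050),
     (- 2102699625, 0, 2102699625, 0), (10209475094320125, 0, 700899875, 0),
     (23882339683271875, 0, 0, 0)]
    [(1, 1, 2, 1401799750, 0), (1647115, 2, 3, 2102699625, 0), (3294230, 1, 2, 700899875, 0),
     (2184936, 0, 1, 33643194000, - 44857592000), (56024, 1, 2, 20244145005, 5141370160),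
     (556010, 2, 3, 15983105088, - 4661738984), (2838550, 0, 2, 0, - 318580194)]"
  by code_simp

lemma valid_run_5:
  "valid_run 957203297254386975000 5
    [(- 11274513719494632522500, 11559871394872847696000, 583562764674500, - 551035398641000),
     (- 118644896657625, 0, 118644896657625, 0), (2048059516917404110250, 0, 79096597771750, 0),
     (3962466150974476946125, 0, 39548298885875, 0), (6237664797073587949500, 0, 0, 0)]
    [(1, 2, 3, 39548298885875, 0), (1689744, 1, 2, 79096597771750, 0),
     (1689744, 2, 3, 39548298885875, 0), (787948, 3, 4, 118644896657625, 0),
     (393974, 2, 3, 79096597771750, 0), (4561410, 1, 2, 39548298885875, 0),
     (9076275, 0, 1, 474579586630500, - 632772782174000),
     (1163625, 1, 2, 146024488194000, 60843536747500),
     (7745088, 2, 3, 85508570490525, - 21716462346800),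
     (21699600, 3, 4, 37994348864682, 9649358441824),
     (290641130, 0, 2, 3605681593098, - 4807575457464)]"
  by code_simp

lemma valid_run_6:
  "valid_run 2049727173888992176638064687500000 6
    [(- 85366354790170352269310018299390625, 69740920126970390882600780188750000,
      17121113594545390625, - 12080603441188750000),
     (- 4111137545902562500, 0, 4111137545902562500, 0),
     (6553694691812471042076653531578125, 0, 3083353159426921875, 0),
     (10653149039590456423137169382218750, 0, 2055568772951281250, 0),
     (19788272057203398326444690876609375, 0, 1027784386475640625, 0),
     (28491112869553854059166364113187500, 0, 0, 0)]
    [(1, 2, 3, 1027784386475640625, 0), (1193947084782192, 1, 2, 2055568772951281250, 0),
     (1193947084782192, 2, 3, 1027784386475640625, 0),
     (41249891008144, 3, 4, 3083353159426921875, 0),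
     (20624945504072, 2, 3, 2055568772951281250, 0),
     (491824492903971, 4, 5, 4111137545902562500, 0),
     (184566443138729, 3, 4, 3083353159426921875, 0),
     (1352781872085400, 2, 3, 1027784386475640625, 0),
     (210298098974250, 1, 2, 2055568772951281250, 0),
     (210298098974250, 2, 3, 1027784386475640625, 0),
     (627698277181500, 0, 1, 14176336365181250000, - 14885153183440312500),
     (105925225710000, 1, 2, 5918830141581000000, 2466179225658750000),
     (157953204220500, 2, 3, 4613600592218750000, - 440389147439062500),
     (1678619626054800, 3, 4, 3391099570912500000, 621701588000625000),
     (2321061998664864, 4, 5, 1865657714222652831, - 701614866887151492),
     (4424437046027661, 0, 2, 440497450663000000, - 330373087997250000)]"
  by code_simp

theorem theorem1p2:
  fixes n :: nat
  assumes "4 \<le> n" and "n \<le> 6" and "CARD('d::finite) \<ge> 2"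
  shows "K n TYPE('d) \<ge> K n TYPE(2) \<and> K n TYPE(2) \<ge> enat (1 + n * (n - 1) div 2)"
proof
  show "K n TYPE('d) \<ge> K n TYPE(2)"
    using assms(3) by (intro K_mono) simp
  consider "n = 4" | "n = 5" | "n = 6"
    using assms(1,2) by linarith
  then show "K n TYPE(2) \<ge> enat (1 + n * (n - 1) div 2)"
  proof cases
    case 1
    have "enat 7 \<le> K 4 TYPE(2)"
      using valid_run_imp_K_ge[OF valid_run_4] by (simp add: numeral_eq_Suc)
    then show ?thesis
      by (simp add: 1)
  next
    case 2
    have "enat 11 \<le> K 5 TYPE(2)"
      using valid_run_imp_K_ge[OF valid_run_5] by (simp add: numeral_eq_Suc)
    then show ?thesis
      by (simp add: 2)
  next
    case 3
    have "enat 16 \<le> K 6 TYPE(2)"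
      using valid_run_imp_K_ge[OF valid_run_6] by (simp add: numeral_eq_Suc)
    then show ?thesis
      by (simp add: 3)
  qed
qed

end
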